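(* Consider the following scheduling problem. There is an unlimited supply of servers. A finite set $\mathcal{J}$ of jobs is given, job $j$ having size (work) $w_j>0$, and all jobs arrive (are available) at time $0$. At any time each job can be processed by at most one server; preemption is allowed, i.e. a job can be halted at any time and resumed later on any server. A server running at speed $s$ consumes power $P(s)=s^\alpha$, where $\alpha>1$ is fixed, and running a job at speed $s$ for duration $t$ completes $st$ units of its work; a job is complete once all of its work is done. At every time $t$, the speeds $s_i(t)$ of the active servers must satisfy the sum-power constraint $\sum_{i: s_i(t)>0} P(s_i(t))\le \mathbf{p}$ for a given $\mathbf{p}>0$. The objective (flow time plus energy) is $$\int n(t)\,dt+\int \sum_{i:s_i(t)>0}P(s_i(t))\,dt,$$ where $n(t)$ is the number of unfinished jobs at time $t$ (so $\int n(t)\,dt=\sum_{j}(d_j-a_j)$ with $d_j$ the completion time and $a_j=0$ the arrival time of job $j$). Algorithm EQUI: at each time $t$, with $n(t)$ unfinished jobs, it processes all $n(t)$ jobs in parallel on $n(t)$ servers, each at the identical speed $s(t)=P^{-1}\!\left(\frac{\min\{n(t),\mathbf{p}\}}{n(t)}\right)$. Then the competitive ratio of EQUI for this flow time plus energy problem (with all jobs available at time $0$) is at most $$\mu(\alpha)=\left(2-\frac{1}{\alpha}\right)\frac{2}{1-\frac{1}{\alpha}}.$$ In particular $\mu(2)=6$, and $\mu(\alpha)$ is a decreasing function of $\alpha>1$.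
   Context: The competitive ratio of an online algorithm $\mathcal{A}$ is $\max_\sigma \frac{\int (n(t)+P_{\mathrm{sum}}(t))\,dt}{\int (n_o(t)+P^o_{\mathrm{sum}}(t))\,dt}$, where the maximum is over all inputs $\sigma$ (job sets with arbitrary sizes), $n(t)$ and $P_{\mathrm{sum}}(t)$ are the number of unfinished jobs and total power used at time $t$ by $\mathcal{A}$, and $n_o(t)$, $P^o_{\mathrm{sum}}(t)$ are the same quantities for an optimal offline algorithm (which knows the whole input in advance) subject to the same constraints. *)

theory Defs
  imports "HOL-Analysis.Analysis"
begin

text \<open>
  Servers are numbered by natural numbers. At each time \<open>t \<ge> 0\<close> a schedule says which job (if any)
  every server is assigned to, and at which speed the server runs; values at \<open>t < 0\<close> are irrelevant.
\<close>

record 'j schedule =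
  assigned :: "nat \<Rightarrow> real \<Rightarrow> 'j option"
  speed :: "nat \<Rightarrow> real \<Rightarrow> real"

definition power_of :: "real \<Rightarrow> real \<Rightarrow> real" where
  "power_of \<alpha> s = s powr \<alpha>"

definition active :: "'j schedule \<Rightarrow> real \<Rightarrow> nat set" where
  "active S t = {i. speed S i t > 0}"

definition total_power :: "real \<Rightarrow> 'j schedule \<Rightarrow> real \<Rightarrow> real" where
  "total_power \<alpha> S t = (\<Sum>i\<in>active S t. power_of \<alpha> (speed S i t))"

text \<open>In a feasible schedule the following sum has at most one summand.\<close>

definition job_speed :: "'j schedule \<Rightarrow> 'j \<Rightarrow> real \<Rightarrow> real" where
  "job_speed S j t = (\<Sum>i | i \<in> active S t \<and> assigned S i t = Some j. speed S i t)"

definition work_done :: "'j schedule \<Rightarrow> 'j \<Rightarrow> real \<Rightarrow> real" where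
  "work_done S j t = integral {0..t} (job_speed S j)"

definition unfinished :: "'j set \<Rightarrow> ('j \<Rightarrow> real) \<Rightarrow> 'j schedule \<Rightarrow> real \<Rightarrow> 'j set" where
  "unfinished J w S t = {j \<in> J. work_done S j t < w j}"

text \<open>
  All jobs are available from time 0 on, so feasibility involves no arrival times. Since an active
  server always works on a job and no two servers work on the same job, \<open>active S t\<close> is finite and
  the sums above are genuine. Together with the power constraint, measurability makes every
  \<open>job_speed S j\<close> integrable on \<open>{0..t}\<close>. Completing all jobs is not demanded: a schedule
  that never completes some job has infinite flow time.
\<close>

definition feasible :: "real \<Rightarrow> real \<Rightarrow> 'j set \<Rightarrow> 'j schedule \<Rightarrow> bool" where
  "feasible \<alpha> p J S \<longleftrightarrow>
     (\<forall>t\<ge>0. (\<forall>i. 0 \<le> speed S i t) \<and>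
             (\<forall>i\<in>active S t. \<exists>j\<in>J. assigned S i t = Some j) \<and>
             (\<forall>i i' j. assigned S i t = Some j \<and> assigned S i' t = Some j \<longrightarrow> i = i') \<and>
             total_power \<alpha> S t \<le> p) \<and>
     (\<forall>j\<in>J. job_speed S j \<in> borel_measurable (lebesgue_on {0..}))"

definition flow_time :: "'j set \<Rightarrow> ('j \<Rightarrow> real) \<Rightarrow> 'j schedule \<Rightarrow> ennreal" where
  "flow_time J w S = (\<integral>\<^sup>+ t. of_nat (card (unfinished J w S t)) \<partial>lebesgue_on {0..})"

definition energy :: "real \<Rightarrow> 'j schedule \<Rightarrow> ennreal" where
  "energy \<alpha> S = (\<integral>\<^sup>+ t. ennreal (total_power \<alpha> S t) \<partial>lebesgue_on {0..})"

definition cost :: "real \<Rightarrow> 'j set \<Rightarrow> ('j \<Rightarrow> real) \<Rightarrow> 'j schedule \<Rightarrow> ennreal" where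
  "cost \<alpha> J w S = flow_time J w S + energy \<alpha> S"

definition opt_cost :: "real \<Rightarrow> real \<Rightarrow> 'j set \<Rightarrow> ('j \<Rightarrow> real) \<Rightarrow> ennreal" where
  "opt_cost \<alpha> p J w = (INF S \<in> {S. feasible \<alpha> p J S}. cost \<alpha> J w S)"

definition instances :: "('j set \<times> ('j \<Rightarrow> real)) set" where
  "instances = {(J, w). finite J \<and> J \<noteq> {} \<and> (\<forall>j\<in>J. 0 < w j)}"

text \<open>
  An algorithm is given by the relation between instances and the schedules it may produce on them
  (for EQUI, the choice of the servers is left open); the ratio is the worst one over all
  instances and all schedules produced.
\<close>

definition competitive_ratio ::
    "real \<Rightarrow> real \<Rightarrow> ('j set \<Rightarrow> ('j \<Rightarrow> real) \<Rightarrow> 'j schedule \<Rightarrow> bool) \<Rightarrow> ennreal" where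
  "competitive_ratio \<alpha> p alg =
     (SUP (J, w) \<in> instances. SUP S \<in> {S. alg J w S}. cost \<alpha> J w S / opt_cost \<alpha> p J w)"

definition equi_speed :: "real \<Rightarrow> real \<Rightarrow> nat \<Rightarrow> real" where
  "equi_speed \<alpha> p n = the_inv_into {0..} (power_of \<alpha>) (min (real n) p / real n)"

definition equi :: "real \<Rightarrow> real \<Rightarrow> 'j set \<Rightarrow> ('j \<Rightarrow> real) \<Rightarrow> 'j schedule \<Rightarrow> bool" where
  "equi \<alpha> p J w S \<longleftrightarrow> feasible \<alpha> p J S \<and>
     (\<forall>t\<ge>0. bij_betw (\<lambda>i. assigned S i t) (active S t) (Some ` unfinished J w S t) \<and>
             (\<forall>i\<in>active S t. speed S i t = equi_speed \<alpha> p (card (unfinished J w S t))))"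

definition mu :: "real \<Rightarrow> real" where
  "mu \<alpha> = (2 - 1 / \<alpha>) * (2 / (1 - 1 / \<alpha>))"


subsection \<open>EQUI is well defined\<close>

lemma equi_speed_eq:
  assumes "\<alpha> > 1" "p > 0" "n > 0"
  shows "equi_speed \<alpha> p n = (min (real n) p / real n) powr (1 / \<alpha>)"
proof -
  have inj: "inj_on (power_of \<alpha>) {0..}"
  proof (rule inj_onI)
    fix x y assume xy: "x \<in> {0..}" "y \<in> {0..}" "power_of \<alpha> x = power_of \<alpha> y"
    show "x = y"
      using powr_less_mono2[of \<alpha> x y] powr_less_mono2[of \<alpha> y x] xy assms(1)
      by (auto simp: power_of_def not_less_iff_gr_or_eq intro: linorder_cases[of x y])
  qed
  have "min (real n) p / real n > 0" using assms by simp
  hence "power_of \<alpha> ((min (real n) p / real n) powr (1 / \<alpha>)) = min (real n) p / real n"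
    using assms by (simp add: power_of_def powr_powr)
  thus ?thesis unfolding equi_speed_def
    by (intro the_inv_into_f_eq[OF inj]) auto
qed

lemma equi_rates_exist:
  fixes w :: "'j \<Rightarrow> real" and e :: "nat \<Rightarrow> real"
  assumes "finite J" and "\<And>j. j \<in> J \<Longrightarrow> 0 < w j" and e: "\<And>n. n > 0 \<Longrightarrow> 0 < e n \<and> e n \<le> 1"
  shows "\<exists>v :: 'j \<Rightarrow> real \<Rightarrow> real. (\<forall>j. v j \<in> borel_measurable borel) \<and>
     (\<forall>j t. 0 \<le> v j t \<and> v j t \<le> 1) \<and>
     (\<exists>T\<ge>0. \<forall>t\<ge>T. \<forall>j\<in>J. w j \<le> integral {0..t} (v j)) \<and>
     (\<forall>t\<ge>0. \<forall>j. v j t = (if j \<in> J \<and> integral {0..t} (v j) < w j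
         then e (card {k\<in>J. integral {0..t} (v k) < w k}) else 0))"
  using assms(1,2)
proof (induction "card J" arbitrary: J w rule: less_induct)
  case less
  show ?case
  proof (cases "J = {}")
    case True
    thus ?thesis by (intro exI[of _ "\<lambda>_ _. 0"]) auto
  next
    case False
    define m where "m = Min (w ` J)"
    define s where "s = e (card J)"
    define \<tau> where "\<tau> = m / s"
    define J' where "J' = {j\<in>J. m < w j}"
    have mle: "m \<le> w j" if "j \<in> J" for j using that less.prems(1) by (simp add: m_def)
    obtain j0 where j0: "j0 \<in> J" "w j0 = m"
      using Min_in[of "w ` J"] less.prems(1) False unfolding m_def
      by (metis (no_types, lifting) finite_imageI image_iff image_is_empty)
    have mpos: "m > 0" using less.prems(2) j0 by metis
    have spos: "0 < s" "s \<le> 1" using e[of "card J"] less.prems(1) False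
      by (auto simp: s_def card_gt_0_iff)
    have \<tau>pos: "\<tau> > 0" using mpos spos by (simp add: \<tau>_def)
    have st: "s * \<tau> = m" using spos by (simp add: \<tau>_def)
    have "card J' < card J"
      by (rule psubset_card_mono[OF less.prems(1)]) (use j0 in \<open>auto simp: J'_def\<close>)
    moreover have "finite J'" using less.prems(1) by (simp add: J'_def)
    moreover have "0 < w j - m" if "j \<in> J'" for j using that by (simp add: J'_def)
    ultimately have "\<exists>v :: 'j \<Rightarrow> real \<Rightarrow> real. (\<forall>j. v j \<in> borel_measurable borel) \<and>
     (\<forall>j t. 0 \<le> v j t \<and> v j t \<le> 1) \<and>
     (\<exists>T\<ge>0. \<forall>t\<ge>T. \<forall>j\<in>J'. w j - m \<le> integral {0..t} (v j)) \<and>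
     (\<forall>t\<ge>0. \<forall>j. v j t = (if j \<in> J' \<and> integral {0..t} (v j) < w j - m
         then e (card {k\<in>J'. integral {0..t} (v k) < w k - m}) else 0))"
      by (rule less.hyps)
    then obtain v :: "'j \<Rightarrow> real \<Rightarrow> real" and T :: real where v:
      "\<And>j. v j \<in> borel_measurable borel" "\<And>j t. 0 \<le> v j t \<and> v j t \<le> 1"
      "T \<ge> 0" "\<And>t j. t \<ge> T \<Longrightarrow> j \<in> J' \<Longrightarrow> w j - m \<le> integral {0..t} (v j)"
      "\<And>t j. t \<ge> 0 \<Longrightarrow> v j t = (if j \<in> J' \<and> integral {0..t} (v j) < w j - m
         then e (card {k\<in>J'. integral {0..t} (v k) < w k - m}) else 0)"
      by blast
    define u where "u j t = (if t < \<tau> then (if j \<in> J then s else 0) else v j (t - \<tau>))" for j t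
    have vint: "v j integrable_on {a..b}" for j a b
    proof (rule measurable_bounded_by_integrable_imp_integrable_real[where g = "\<lambda>_. 1"])
      show "v j \<in> borel_measurable (lebesgue_on {a..b})"
        by (intro measurable_restrict_space1 measurable_completion) (use v(1) in simp)
    qed (use v(2) in auto)
    have um: "u j \<in> borel_measurable borel" for j
      unfolding u_def using v(1)[measurable] by measurable
    have u1: "integral {0..t} (u j) = s * t" if "0 \<le> t" "t \<le> \<tau>" "j \<in> J" for j t
    proof -
      have "integral {0..t} (u j) = integral {0..t} (\<lambda>_. s)"
        by (rule integral_spike[of "{\<tau>}"]) (use that in \<open>auto simp: u_def\<close>)
      thus ?thesis using that by simp
    qed
    have u2: "integral {0..t} (u j) = m + integral {0..t-\<tau>} (v j)" if "\<tau> \<le> t" "j \<in> J" for j t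
    proof -
      have "((\<lambda>x. v j (x - \<tau>)) has_integral integral {0..t-\<tau>} (v j)) {\<tau>..t}"
        using has_integral_shift_real_ivl[of "v j" "integral {0..t-\<tau>} (v j)" 0 "t-\<tau>" "-\<tau>"]
          integrable_integral[OF vint[of j 0 "t-\<tau>"]] by simp
      hence A: "(u j has_integral integral {0..t-\<tau>} (v j)) {\<tau>..t}"
        by (rule has_integral_eq[rotated]) (auto simp: u_def)
      have "((\<lambda>_. s) has_integral m) {0..\<tau>}"
        using has_integral_const_real[of s 0 \<tau>] \<tau>pos st by (simp add: mult.commute)
      hence B: "(u j has_integral m) {0..\<tau>}"
        by (rule has_integral_spike[of "{\<tau>}", rotated 2]) (use that in \<open>auto simp: u_def\<close>)
      show ?thesis
        using has_integral_combine[OF _ that(1) B A] \<tau>pos by (simp add: integral_unique)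
    qed
    have v0: "v j t = 0" if "t \<ge> 0" "j \<notin> J'" for j t using v(5)[OF that(1), of j] that(2) by simp
    have iv0: "integral {0..t} (v j) \<ge> 0" for j t
      by (rule integral_nonneg) (use vint v(2) in auto)
    show ?thesis
    proof (intro exI[of _ u] conjI)
      show "\<forall>j. u j \<in> borel_measurable borel" using um by blast
      show "\<forall>j t. 0 \<le> u j t \<and> u j t \<le> 1" using v(2) spos by (auto simp: u_def)
      show "\<exists>T\<ge>0. \<forall>t\<ge>T. \<forall>j\<in>J. w j \<le> integral {0..t} (u j)"
      proof (intro exI[of _ "\<tau> + T"] conjI allI impI ballI)
        show "0 \<le> \<tau> + T" using \<tau>pos v(3) by simp
        fix t j assume t: "\<tau> + T \<le> t" and j: "j \<in> J"
        show "w j \<le> integral {0..t} (u j)"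
        proof (cases "j \<in> J'")
          case True
          thus ?thesis using u2[of t j] v(4)[of "t - \<tau>" j] t j v(3) by simp
        next
          case False
          hence "w j = m" using mle[OF j] j by (auto simp: J'_def)
          thus ?thesis using u2[of t j] iv0[of "t-\<tau>" j] t j v(3) by simp
        qed
      qed
      show "\<forall>t\<ge>0. \<forall>j. u j t = (if j \<in> J \<and> integral {0..t} (u j) < w j
         then e (card {k\<in>J. integral {0..t} (u k) < w k}) else 0)"
      proof (intro allI impI)
        fix t :: real and j assume t: "0 \<le> t"
        show "u j t = (if j \<in> J \<and> integral {0..t} (u j) < w j
         then e (card {k\<in>J. integral {0..t} (u k) < w k}) else 0)"
        proof (cases "t < \<tau>")
          case True
          have "s * t < m" using True spos(1) st by (metis mult_less_cancel_left_pos)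
          hence less: "integral {0..t} (u k) < w k" if "k \<in> J" for k
            using u1[of t k] True t mle[OF that] that by auto
          hence "{k\<in>J. integral {0..t} (u k) < w k} = J" by auto
          thus ?thesis using less True by (simp add: u_def s_def)
        next
          case False
          have eq: "k \<in> J \<and> integral {0..t} (u k) < w k \<longleftrightarrow>
              k \<in> J' \<and> integral {0..t-\<tau>} (v k) < w k - m" for k
            using u2[of t k] False iv0[of "t-\<tau>" k] by (auto simp: J'_def)
          show ?thesis unfolding eq using False v(5)[of "t-\<tau>" j] by (simp add: u_def)
        qed
      qed
    qed
  qed
qed

lemma equi_exists:
  fixes w :: "'j \<Rightarrow> real"
  assumes "\<alpha> > 1" "p > 0" "finite J" "\<And>j. j \<in> J \<Longrightarrow> 0 < w j"
  shows "\<exists>S. equi \<alpha> p J w S \<and> cost \<alpha> J w S < \<infinity>"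
proof -
  define e where "e = equi_speed \<alpha> p"
  have e: "0 < e n \<and> e n \<le> 1" if "n > 0" for n
  proof -
    have "min (real n) p / real n \<le> 1" "min (real n) p / real n > 0" using that assms by auto
    thus ?thesis using equi_speed_eq[OF assms(1,2) that] assms that
      powr_le1[of "1 / \<alpha>" "min (real n) p / real n"]
      unfolding e_def by (simp only: powr_gt_zero) simp
  qed
  have Pe: "real n * power_of \<alpha> (e n) = min (real n) p" if "n > 0" for n
  proof -
    have "min (real n) p / real n > 0" using that assms by auto
    thus ?thesis using equi_speed_eq[OF assms(1,2) that] assms that
      by (simp add: e_def power_of_def powr_powr)
  qed
  have "\<exists>v :: 'j \<Rightarrow> real \<Rightarrow> real. (\<forall>j. v j \<in> borel_measurable borel) \<and>
     (\<forall>j t. 0 \<le> v j t \<and> v j t \<le> 1) \<and>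
     (\<exists>T\<ge>0. \<forall>t\<ge>T. \<forall>j\<in>J. w j \<le> integral {0..t} (v j)) \<and>
     (\<forall>t\<ge>0. \<forall>j. v j t = (if j \<in> J \<and> integral {0..t} (v j) < w j
         then e (card {k\<in>J. integral {0..t} (v k) < w k}) else 0))"
    by (rule equi_rates_exist) (fact assms(3), fact assms(4), fact e)
  then obtain v :: "'j \<Rightarrow> real \<Rightarrow> real" and T :: real where v:
      "\<And>j. v j \<in> borel_measurable borel"
      "\<And>j t. 0 \<le> v j t \<and> v j t \<le> 1"
      "T \<ge> 0" "\<And>t j. t \<ge> T \<Longrightarrow> j \<in> J \<Longrightarrow> w j \<le> integral {0..t} (v j)"
      "\<And>t j. t \<ge> 0 \<Longrightarrow> v j t = (if j \<in> J \<and> integral {0..t} (v j) < w j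
         then e (card {k\<in>J. integral {0..t} (v k) < w k}) else 0)"
    by blast
  define U where "U t = {k\<in>J. integral {0..t} (v k) < w k}" for t
  have finU: "finite (U t)" for t using assms(3) by (simp add: U_def)
  obtain f :: "'j \<Rightarrow> nat" where f: "inj_on f J"
    using finite_imp_inj_to_nat_seg[OF assms(3)] by blast
  define S where "S = \<lparr>
     assigned = (\<lambda>i t. if i \<in> f ` U t then Some (the_inv_into J f i) else None),
     speed = (\<lambda>i t. if i \<in> f ` U t then e (card (U t)) else 0)\<rparr>"
  have UJ: "U t \<subseteq> J" for t by (auto simp: U_def)
  have inv: "the_inv_into J f (f j) = j" if "j \<in> U t" for j t
    using the_inv_into_f_f[OF f] that UJ by blast
  have ecard: "0 < e (card (U t))" if "j \<in> U t" for j t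
    using that e finU card_gt_0_iff by (metis empty_iff)
  have act: "active S t = f ` U t" for t
    using ecard by (auto simp: active_def S_def)
  have asg: "assigned S i t = Some j \<longleftrightarrow> j \<in> U t \<and> i = f j" for i j t
    by (auto simp: S_def inv)
  have sp: "speed S (f j) t = e (card (U t))" if "j \<in> U t" for j t
    using that by (simp add: S_def)
  have js: "job_speed S j t = v j t" if "t \<ge> 0" for j t
  proof -
    have "{i. i \<in> active S t \<and> assigned S i t = Some j} = (if j \<in> U t then {f j} else {})"
      by (auto simp: act asg)
    thus ?thesis using v(5)[OF that, of j] sp[of j t]
      by (auto simp: job_speed_def U_def)
  qed
  have wd: "work_done S j t = integral {0..t} (v j)" for j t
    unfolding work_done_def by (rule integral_cong) (simp add: js)
  have unf: "unfinished J w S t = U t" for t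
    by (simp add: unfinished_def wd U_def)
  have tp: "total_power \<alpha> S t = (if U t = {} then 0 else min (real (card (U t))) p)" for t
  proof -
    have "total_power \<alpha> S t = (\<Sum>j\<in>U t. power_of \<alpha> (speed S (f j) t))"
      unfolding total_power_def act
      using sum.reindex[OF inj_on_subset[OF f UJ[of t]]] by (simp add: o_def)
    also have "\<dots> = real (card (U t)) * power_of \<alpha> (e (card (U t)))"
      by (simp add: sp)
    finally show ?thesis using Pe[of "card (U t)"] finU[of t] by (auto simp: card_gt_0_iff)
  qed
  have feas: "feasible \<alpha> p J S"
    unfolding feasible_def
  proof (intro conjI allI impI ballI)
    fix t :: real and i
    show "0 \<le> speed S i t" using ecard by (auto simp: S_def intro: less_imp_le)
    show "\<exists>j\<in>J. assigned S i t = Some j" if "i \<in> active S t"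
      using that UJ by (auto simp: act asg)
    show "i = i'" if "assigned S i t = Some j \<and> assigned S i' t = Some j" for i' j
      using that by (auto simp: asg)
    show "total_power \<alpha> S t \<le> p" using assms(2) by (auto simp: tp)
  next
    fix j
    have "v j \<in> borel_measurable (lebesgue_on {0..})"
      by (intro measurable_restrict_space1 measurable_completion) (use v(1) in simp)
    thus "job_speed S j \<in> borel_measurable (lebesgue_on {0..})"
      by (subst measurable_cong[where g = "v j"]) (auto simp: js)
  qed
  moreover have "bij_betw (\<lambda>i. assigned S i t) (active S t) (Some ` unfinished J w S t)" for t
    unfolding bij_betw_def inj_on_def act unf by (auto simp: S_def inv image_iff)
  ultimately have "equi \<alpha> p J w S"
    unfolding equi_def by (auto simp: act unf sp e_def[symmetric])
  moreover have "cost \<alpha> J w S < \<infinity>"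
  proof -
    have UT: "U t = {}" if "t \<ge> T" for t using v(4)[OF that] by (force simp: U_def)
    have fin: "(\<integral>\<^sup>+ t. ennreal c * indicator {0..T} t \<partial>lebesgue_on {0..}) < \<infinity>" for c :: real
    proof -
      have "(\<integral>\<^sup>+ t. ennreal c * indicator {0..T} t \<partial>lebesgue_on {0..}) =
        ennreal c * emeasure (lebesgue_on {0..}) {0..T}"
        by (rule nn_integral_cmult_indicator) (auto simp: sets_restrict_space)
      also have "emeasure (lebesgue_on {0..}) {0..T} = emeasure lebesgue {0..T}"
        by (rule emeasure_restrict_space) auto
      finally show ?thesis using v(3) by (simp add: ennreal_mult_less_top)
    qed
    have "flow_time J w S \<le> (\<integral>\<^sup>+ t. ennreal (real (card J)) * indicator {0..T} t \<partial>lebesgue_on {0..})"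
      unfolding flow_time_def unf
    proof (rule nn_integral_mono)
      fix t assume "t \<in> space (lebesgue_on {0::real..})"
      thus "of_nat (card (U t)) \<le> ennreal (real (card J)) * indicator {0..T} t"
        using UT[of t] card_mono[OF assms(3) UJ[of t]]
        by (cases "t \<le> T") (auto simp: indicator_def ennreal_of_nat_eq_real_of_nat)
    qed
    moreover have "energy \<alpha> S \<le> (\<integral>\<^sup>+ t. ennreal p * indicator {0..T} t \<partial>lebesgue_on {0..})"
      unfolding energy_def
    proof (rule nn_integral_mono)
      fix t assume "t \<in> space (lebesgue_on {0::real..})"
      thus "ennreal (total_power \<alpha> S t) \<le> ennreal p * indicator {0..T} t"
        using UT[of t] by (cases "t \<le> T") (auto simp: indicator_def tp intro!: ennreal_leI)
    qed
    ultimately show ?thesis unfolding cost_def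
      using fin[of "real (card J)"] fin[of p] by (auto simp: less_top[symmetric] top_unique)
  qed
  ultimately show ?thesis by blast
qed

end

theory Submission
  imports Defs
begin

text \<open>
  Write \<open>b = 1/\<alpha>\<close>. Fix a competing schedule of finite cost with completion times \<open>C j\<close>, and weight job
  \<open>j\<close> by \<open>a j = (r j / p) powr b\<close>, where \<open>r j\<close> is the number of jobs completing no earlier than \<open>j\<close>.
  If \<open>n\<close> jobs are unfinished at some time, each of them has \<open>r j \<le> n\<close>, so Young's inequality and
  the power constraint bound the weighted sum of their speeds by \<open>n\<close>; integrating,
  \<open>\<Sum>j. a j * w j\<close> is at most the flow time. Likewise \<open>s \<le> 1 + s powr \<alpha>\<close> shows that \<open>\<Sum>j. w j\<close> is
  at most the total cost.

  In EQUI, the \<open>n\<close> unfinished jobs run at a common speed \<open>s\<close>. Any \<open>n\<close> jobs satisfy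
  \<open>\<Sum>j. r j powr b \<ge> n powr (1 + b) / (1 + b)\<close>, whence \<open>n \<le> \<Sum>j. (1 + (1 + b) * a j) * s\<close>, and
  integrating bounds the flow time of EQUI by \<open>\<Sum>j. (1 + (1 + b) * a j) * w j\<close>, that is by \<open>2 + b\<close>
  times the competing cost. The energy of EQUI is at most its flow time, and
  \<open>2 * (2 + b) \<le> mu \<alpha>\<close>.
\<close>

section \<open>Real inequalities\<close>

text \<open>Bernoulli's inequality for real exponents: Young's inequality for
  \<open>x powr a\<close> and \<open>1\<close> with weights \<open>1/a\<close> and
  \<open>1 - 1/a\<close>, cleared of the factor \<open>1/a\<close>.\<close>

lemma powr_ge_tangent_at_1:
  fixes x a :: real
  assumes "x \<ge> 0" "a \<ge> 1"
  shows "1 + a * (x - 1) \<le> x powr a"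
proof (cases "x = 0")
  case True
  thus ?thesis using assms by simp
next
  case False
  hence "(x powr a) powr (1/a) * 1 powr (1 - 1/a) \<le> (1/a) * x powr a + (1 - 1/a) * 1"
    using assms by (intro Youngs_inequality_0) auto
  hence "x \<le> x powr a / a + (1 - 1/a)"
    using assms False by (simp add: powr_powr)
  hence "a * x \<le> a * (x powr a / a + (1 - 1/a))"
    using assms by (intro mult_left_mono) auto
  also have "\<dots> = x powr a + a - 1" using assms by (simp add: field_simps)
  finally show ?thesis by (simp add: algebra_simps)
qed

text \<open>One step of comparing a sum of \<open>k powr b\<close> with the integral of that power:
  the tangent bound at the ratio \<open>n / Suc n\<close>, scaled by
  \<open>Suc n powr (1 + b)\<close>.\<close>

lemma nat_powr_diff_le:
  fixes b :: real
  assumes "b \<ge> 0"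
  shows "real (Suc n) powr (1 + b) / (1 + b)
    \<le> real n powr (1 + b) / (1 + b) + real (Suc n) powr b"
proof -
  define x where "x = real n / real (Suc n)"
  have "1 + (1 + b) * (x - 1) \<le> x powr (1 + b)"
    using assms by (intro powr_ge_tangent_at_1) (auto simp: x_def)
  moreover have "x - 1 = - 1 / real (Suc n)" by (simp add: x_def field_simps)
  ultimately have "1 - (1 + b) / real (Suc n) \<le> x powr (1 + b)" by simp
  hence "real (Suc n) powr (1 + b) * (1 - (1 + b) / real (Suc n))
      \<le> real (Suc n) powr (1 + b) * x powr (1 + b)"
    by (rule mult_left_mono) simp
  also have "\<dots> = real n powr (1 + b)"
    unfolding x_def by (subst powr_mult[symmetric]) auto
  also have "real (Suc n) powr (1 + b) * (1 - (1 + b) / real (Suc n))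
      = real (Suc n) powr (1 + b) - (1 + b) * real (Suc n) powr b"
    by (simp add: powr_add field_simps)
  finally have "real (Suc n) powr (1 + b) \<le> real n powr (1 + b) + (1 + b) * real (Suc n) powr b"
    by simp
  hence "real (Suc n) powr (1 + b) / (1 + b)
      \<le> (real n powr (1 + b) + (1 + b) * real (Suc n) powr b) / (1 + b)"
    using assms by (intro divide_right_mono) auto
  thus ?thesis using assms by (simp add: add_divide_distrib)
qed

text \<open>Remove a job of \<open>X\<close> with minimal \<open>C\<close>. Its rank, taken in all
  of \<open>J\<close>, counts every job of \<open>X\<close> and so is at least
  \<open>card X\<close>; the remaining jobs are covered by induction, and
  \<open>nat_powr_diff_le\<close> joins the two bounds.\<close>

lemma sum_rank_powr_ge:
  fixes C :: "'a \<Rightarrow> real" and b :: real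
  assumes "finite J" "X \<subseteq> J" "b \<ge> 0"
  shows "real (card X) powr (1 + b) / (1 + b) \<le> (\<Sum>j\<in>X. real (card {k\<in>J. C j \<le> C k}) powr b)"
  using finite_subset[OF assms(2,1)] assms(2)
proof (induction "card X" arbitrary: X)
  case 0
  thus ?case by simp
next
  case (Suc n)
  hence "X \<noteq> {}" by auto
  then obtain j where j: "j \<in> X" "\<And>k. k \<in> X \<Longrightarrow> C j \<le> C k"
    using ex_min_if_finite[of "C ` X"] Suc.prems(1) by (auto simp: not_less)
  have "card X \<le> card {k\<in>J. C j \<le> C k}"
    by (rule card_mono) (use assms(1) Suc.prems(2) j in auto)
  hence "real (Suc n) powr b \<le> real (card {k\<in>J. C j \<le> C k}) powr b"
    using Suc.hyps(2) assms(3) by (intro powr_mono2) auto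
  moreover have "real n powr (1 + b) / (1 + b)
      \<le> (\<Sum>j\<in>X - {j}. real (card {k\<in>J. C j \<le> C k}) powr b)"
  proof -
    have "card (X - {j}) = n" using Suc.hyps(2) Suc.prems(1) j(1) by simp
    thus ?thesis using Suc.hyps(1)[of "X - {j}"] Suc.prems by auto
  qed
  ultimately show ?case
    using nat_powr_diff_le[OF assms(3), of n] Suc.hyps(2) 
      sum.remove[OF Suc.prems(1) j(1), of "\<lambda>j. real (card {k\<in>J. C j \<le> C k}) powr b"]
    by simp
qed

section \<open>Cumulative integrals of bounded nonnegative functions\<close>

text \<open>This abstracts the speed of a single job, with the integral over \<open>{0..t}\<close>
  as its work done. The bound yields integrability on each such interval.\<close>

locale bounded_rate =
  fixes f :: "real \<Rightarrow> real" and B :: real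
  assumes meas: "f \<in> borel_measurable (lebesgue_on {0..})"
    and nonneg: "t \<ge> 0 \<Longrightarrow> 0 \<le> f t"
    and bound: "t \<ge> 0 \<Longrightarrow> f t \<le> B"
begin

lemma integrable: "f integrable_on {0..t}"
proof (rule measurable_bounded_by_integrable_imp_integrable_real[where g = "\<lambda>_. B"])
  show "f \<in> borel_measurable (lebesgue_on {0..t})"
    by (rule measurable_restrict_mono[OF meas]) auto
qed (use nonneg bound in auto)

lemma cumulative_mono: "s \<le> t \<Longrightarrow> integral {0..s} f \<le> integral {0..t} f"
  using integrable nonneg by (intro integral_subset_le) auto

text \<open>This links the two integrals in the definitions: work is measured by
  \<open>integral\<close>, cost by the nonnegative Lebesgue integral on
  \<open>{0..}\<close>.\<close>

lemma nn_integral_initial: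
  "(\<integral>\<^sup>+ t. ennreal (f t) * indicator {0..c} t \<partial>lebesgue_on {0..}) = ennreal (integral {0..c} f)"
proof -
  have "f absolutely_integrable_on {0..c}"
    using integrable nonneg by (intro nonnegative_absolutely_integrable_1) auto
  hence int: "integrable (lebesgue_on {0..c}) f"
    by (simp add: integrable_restrict_space set_integrable_def)
  have "(\<integral>\<^sup>+ t. ennreal (f t) * indicator {0..c} t \<partial>lebesgue_on {0..})
      = (\<integral>\<^sup>+ t. ennreal (f t) * indicator {0..c} t * indicator {0..} t \<partial>lebesgue)"
    by (subst nn_integral_restrict_space) auto
  also have "\<dots> = (\<integral>\<^sup>+ t. ennreal (f t) * indicator {0..c} t \<partial>lebesgue)"
    by (intro nn_integral_cong) (auto simp: indicator_def)
  also have "\<dots> = (\<integral>\<^sup>+ t. ennreal (f t) \<partial>lebesgue_on {0..c})"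
    by (subst nn_integral_restrict_space) auto
  also have "\<dots> = ennreal (\<integral>t. f t \<partial>lebesgue_on {0..c})"
    by (rule nn_integral_eq_integral[OF int])
       (auto intro!: AE_I2 nonneg)
  also have "(\<integral>t. f t \<partial>lebesgue_on {0..c}) = integral {0..c} f"
    by (rule lebesgue_integral_eq_integral[OF int]) simp
  finally show ?thesis .
qed

text \<open>The endpoint is a null set. The half-open interval matches the convention that a job is
  unfinished exactly while \<open>t < c\<close>.\<close>

lemma nn_integral_initial_open:
  "(\<integral>\<^sup>+ t. ennreal (f t) * indicator {0..<c} t \<partial>lebesgue_on {0..}) = ennreal (integral {0..c} f)"
proof -
  have "AE t in lebesgue_on {0..}. t \<noteq> c"
    using AE_completion[OF AE_lborel_singleton[of c]] by (subst AE_restrict_space_iff) auto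
  hence "(\<integral>\<^sup>+ t. ennreal (f t) * indicator {0..<c} t \<partial>lebesgue_on {0..})
      = (\<integral>\<^sup>+ t. ennreal (f t) * indicator {0..c} t \<partial>lebesgue_on {0..})"
    by (intro nn_integral_cong_AE, eventually_elim) (auto simp: indicator_def)
  thus ?thesis by (simp add: nn_integral_initial)
qed

text \<open>By continuity the times in \<open>{0..t0}\<close> at which level \<open>w\<close> has
  been reached form a closed set, and \<open>c\<close> is its least element. Monotonicity gives the
  equivalence.\<close>

lemma hitting_time:
  assumes "t0 \<ge> 0" "w \<le> integral {0..t0} f" "w > 0"
  obtains c where "\<And>t. t \<ge> 0 \<Longrightarrow> integral {0..t} f < w \<longleftrightarrow> t < c"
    "integral {0..c} f = w"
proof -
  define A where "A = {t\<in>{0..t0}. w \<le> integral {0..t} f}"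
  have cont: "continuous_on {0..t0} (\<lambda>t. integral {0..t} f)"
    by (rule indefinite_integral_continuous_1[OF integrable])
  have "closed A" unfolding A_def
    by (rule continuous_on_closed_Collect_le) (auto intro!: cont)
  moreover have "A \<noteq> {}" "bdd_below A" using assms by (auto simp: A_def)
  ultimately have cA: "Inf A \<in> A" by (rule closed_contains_Inf[rotated 2])
  define c where "c = Inf A"
  have c: "0 \<le> c" "c \<le> t0" "w \<le> integral {0..c} f" using cA by (auto simp: A_def c_def)
  have le: "c \<le> t" if "t \<ge> 0" "w \<le> integral {0..t} f" for t
  proof (cases "t \<le> t0")
    case True
    thus ?thesis unfolding c_def using that \<open>bdd_below A\<close>
      by (intro cInf_lower) (auto simp: A_def)
  qed (use c in auto)
  have iff: "integral {0..t} f < w \<longleftrightarrow> t < c" if "t \<ge> 0" for t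
    using le[OF that] cumulative_mono[of c t] c(3) by force
  moreover have "integral {0..c} f = w"
  proof -
    \<comment> \<open>The level is attained somewhere in \<open>{0..c}\<close>, and no time before
      \<open>c\<close> reaches it, so the point found is \<open>c\<close> itself.\<close>
    obtain x where x: "0 \<le> x" "x \<le> c" "integral {0..x} f = w"
      using IVT'[of "\<lambda>t. integral {0..t} f" 0 w c] c assms(3)
        continuous_on_subset[OF cont, of "{0..c}"] by auto
    with iff[of x] have "x = c" by auto
    with x show ?thesis by simp
  qed
  ultimately show ?thesis using that by blast
qed

text \<open>This serves EQUI, for which completion of the jobs need not be known beforehand. Either
  \<open>w\<close> is reached and \<open>f\<close> vanishes afterwards, or all partial integrals
  stay below \<open>w\<close> and monotone convergence over \<open>{0..n}\<close> applies.\<close>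

lemma nn_integral_le_if_stopping:
  assumes stop: "\<And>t. t \<ge> 0 \<Longrightarrow> w \<le> integral {0..t} f \<Longrightarrow> f t = 0" and "w > 0"
  shows "(\<integral>\<^sup>+ t. ennreal (f t) \<partial>lebesgue_on {0..}) \<le> ennreal w"
proof (cases "\<exists>t0\<ge>0. w \<le> integral {0..t0} f")
  case True
  then obtain c where c: "\<And>t. t \<ge> 0 \<Longrightarrow> integral {0..t} f < w \<longleftrightarrow> t < c"
    "integral {0..c} f = w"
    using hitting_time assms(2) by metis
  have "(\<integral>\<^sup>+ t. ennreal (f t) \<partial>lebesgue_on {0..})
      \<le> (\<integral>\<^sup>+ t. ennreal (f t) * indicator {0..c} t \<partial>lebesgue_on {0..})"
  proof (rule nn_integral_mono)
    fix t assume "t \<in> space (lebesgue_on {0::real..})"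
    hence "t \<ge> 0" by simp
    thus "ennreal (f t) \<le> ennreal (f t) * indicator {0..c} t"
      using c(1)[of t] stop[of t] by (cases "t \<le> c") (auto simp: not_less)
  qed
  thus ?thesis by (simp add: nn_integral_initial c(2))
next
  case False
  define g where "g n t = ennreal (f t) * indicator {0..real n} t" for n :: nat and t
  have inc: "incseq g"
    by (auto simp: incseq_def le_fun_def g_def indicator_def)
  have sup: "(SUP n. g n t) = ennreal (f t)" if "t \<ge> 0" for t
  proof (rule antisym)
    show "(SUP n. g n t) \<le> ennreal (f t)"
      by (rule SUP_least) (auto simp: g_def indicator_def)
    obtain n where "t \<le> real n" using real_arch_simple by blast
    hence "ennreal (f t) = g n t" using that by (simp add: g_def)
    thus "ennreal (f t) \<le> (SUP n. g n t)" by (metis SUP_upper UNIV_I)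
  qed
  have [measurable]: "g n \<in> borel_measurable (lebesgue_on {0..})" for n
    unfolding g_def
    by (intro borel_measurable_times_ennreal measurable_compose[OF meas measurable_ennreal]
          borel_measurable_indicator) (auto simp: sets_restrict_space)
  have "(\<integral>\<^sup>+ t. ennreal (f t) \<partial>lebesgue_on {0..}) = (\<integral>\<^sup>+ t. (SUP n. g n t) \<partial>lebesgue_on {0..})"
    by (intro nn_integral_cong) (simp add: sup)
  also have "\<dots> = (SUP n. \<integral>\<^sup>+ t. g n t \<partial>lebesgue_on {0..})"
    by (rule nn_integral_monotone_convergence_SUP[OF inc]) measurable
  also have "\<dots> \<le> ennreal w"
  proof (rule SUP_least)
    fix n :: nat
    have "integral {0..real n} f \<le> w" using False by (meson linear of_nat_0_le_iff)
    thus "(\<integral>\<^sup>+ t. g n t \<partial>lebesgue_on {0..}) \<le> ennreal w"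
      unfolding g_def nn_integral_initial by (rule ennreal_leI)
  qed
  finally show ?thesis .
qed

end

section \<open>Feasible schedules\<close>

lemma job_speed_active:
  assumes "feasible \<alpha> p J S" "t \<ge> 0" "i \<in> active S t" "assigned S i t = Some j"
  shows "job_speed S j t = speed S i t"
proof -
  have "{i. i \<in> active S t \<and> assigned S i t = Some j} = {i}"
    using assms by (auto simp: feasible_def)
  thus ?thesis by (simp add: job_speed_def)
qed

lemma job_speed_idle:
  assumes "\<And>i. i \<in> active S t \<Longrightarrow> assigned S i t \<noteq> Some j"
  shows "job_speed S j t = 0"
proof -
  have "{i. i \<in> active S t \<and> assigned S i t = Some j} = {}" using assms by auto
  thus ?thesis unfolding job_speed_def by (simp only: sum.empty)
qed

lemma job_speed_nonneg: "0 \<le> job_speed S j t"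
  unfolding job_speed_def by (intro sum_nonneg) (auto simp: active_def)

text \<open>Passage from servers to jobs: active servers correspond injectively to the jobs they
  process, and all other jobs contribute \<open>0 powr \<alpha> = 0\<close>.\<close>

lemma sum_job_speed_powr:
  assumes "feasible \<alpha> p J S" "finite J" "t \<ge> 0"
  shows "(\<Sum>j\<in>J. job_speed S j t powr \<alpha>) = total_power \<alpha> S t"
proof -
  define job where "job i = the (assigned S i t)" for i
  have job: "job i \<in> J" "assigned S i t = Some (job i)" if "i \<in> active S t" for i
  proof -
    obtain j where "j \<in> J" "assigned S i t = Some j"
      using assms(1,3) \<open>i \<in> active S t\<close> unfolding feasible_def by blast
    thus "job i \<in> J" "assigned S i t = Some (job i)" by (auto simp: job_def)
  qed
  have inj: "inj_on job (active S t)"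
  proof (rule inj_onI)
    fix i i' assume "i \<in> active S t" "i' \<in> active S t" "job i = job i'"
    thus "i = i'" using job(2)[of i] job(2)[of i'] assms(1,3) unfolding feasible_def by metis
  qed
  have "(\<Sum>j\<in>J. job_speed S j t powr \<alpha>) = (\<Sum>j\<in>job ` active S t. job_speed S j t powr \<alpha>)"
  proof (rule sum.mono_neutral_right)
    show "\<forall>j\<in>J - job ` active S t. job_speed S j t powr \<alpha> = 0"
      by (auto simp: job_def image_iff intro!: job_speed_idle) (metis option.sel)
  qed (use assms job in auto)
  also have "\<dots> = (\<Sum>i\<in>active S t. job_speed S (job i) t powr \<alpha>)"
    using sum.reindex[OF inj] by (simp add: o_def)
  also have "\<dots> = total_power \<alpha> S t"
    unfolding total_power_def power_of_def
    by (intro sum.cong refl) (simp add: job_speed_active[OF assms(1,3) _ job(2)])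
  finally show ?thesis .
qed

lemma bounded_rate_job_speed:
  assumes "feasible \<alpha> p J S" "finite J" "j \<in> J" "\<alpha> > 0"
  shows "bounded_rate (job_speed S j) (p powr (1 / \<alpha>))"
proof
  show "job_speed S j \<in> borel_measurable (lebesgue_on {0..})"
    using assms by (simp add: feasible_def)
  fix t :: real assume t: "t \<ge> 0"
  show "0 \<le> job_speed S j t" by (rule job_speed_nonneg)
  have "job_speed S j t powr \<alpha> \<le> (\<Sum>j\<in>J. job_speed S j t powr \<alpha>)"
    using assms by (intro member_le_sum) auto
  also have "\<dots> = total_power \<alpha> S t" by (rule sum_job_speed_powr[OF assms(1,2) t])
  also have "\<dots> \<le> p" using assms(1) t by (simp add: feasible_def)
  finally have "(job_speed S j t powr \<alpha>) powr (1 / \<alpha>) \<le> p powr (1 / \<alpha>)"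
    using assms by (intro powr_mono2) auto
  thus "job_speed S j t \<le> p powr (1 / \<alpha>)"
    using assms(4) job_speed_nonneg[of S j t] by (simp add: powr_powr)
qed

text \<open>This is a relation because a schedule may never complete some job. The equivalence
  describes the unfinished jobs at time \<open>t\<close> as those with \<open>t < C j\<close>, which
  makes them comparable with ranks.\<close>

definition completion_times ::
    "'j set \<Rightarrow> ('j \<Rightarrow> real) \<Rightarrow> 'j schedule \<Rightarrow> ('j \<Rightarrow> real) \<Rightarrow> bool" where
  "completion_times J w S C \<longleftrightarrow> (\<forall>j\<in>J. work_done S j (C j) = w j \<and>
     (\<forall>t\<ge>0. work_done S j t < w j \<longleftrightarrow> t < C j))"

lemma unfinished_eq:
  "completion_times J w S C \<Longrightarrow> t \<ge> 0 \<Longrightarrow> unfinished J w S t = {j\<in>J. t < C j}"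
  by (auto simp: unfinished_def completion_times_def)

text \<open>A job that is never completed adds at least 1 to the flow time integrand at all times,
  so the flow time would be infinite. Otherwise \<open>hitting_time\<close> supplies its completion
  time.\<close>

lemma completion_times_exist:
  assumes "feasible \<alpha> p J S" "finite J" "\<alpha> > 0" "\<And>j. j \<in> J \<Longrightarrow> 0 < w j"
    and fin: "flow_time J w S < \<infinity>"
  shows "\<exists>C. completion_times J w S C"
proof -
  have "\<exists>c. work_done S j c = w j \<and> (\<forall>t\<ge>0. work_done S j t < w j \<longleftrightarrow> t < c)"
    if j: "j \<in> J" for j
  proof -
    interpret bounded_rate "job_speed S j" "p powr (1 / \<alpha>)"
      by (rule bounded_rate_job_speed[OF assms(1,2) j assms(3)])
    have "\<exists>t0\<ge>0. w j \<le> work_done S j t0"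
    proof (rule ccontr)
      assume never: "\<not> (\<exists>t0\<ge>0. w j \<le> work_done S j t0)"
      have "(\<integral>\<^sup>+ t. 1 \<partial>lebesgue_on {0::real..}) \<le> flow_time J w S"
        unfolding flow_time_def
      proof (rule nn_integral_mono)
        fix t assume "t \<in> space (lebesgue_on {0::real..})"
        hence "j \<in> unfinished J w S t" using never j by (auto simp: unfinished_def)
        hence "card (unfinished J w S t) \<ge> 1"
          using assms(2) by (auto simp: unfinished_def Suc_le_eq card_gt_0_iff)
        thus "1 \<le> (of_nat (card (unfinished J w S t)) :: ennreal)"
          using of_nat_mono[of 1 "card (unfinished J w S t)", where 'a = ennreal] by simp
      qed
      moreover have "(\<integral>\<^sup>+ t. 1 \<partial>lebesgue_on {0::real..}) = \<infinity>"
      proof -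
        have "of_nat n \<le> emeasure lborel {0::real..}" for n
          using emeasure_mono[of "{0..real n}" "{0..}" lborel]
          by (simp add: ennreal_of_nat_eq_real_of_nat)
        hence "emeasure lborel {0::real..} = \<infinity>"
          using ennreal_Ex_less_of_nat[of "emeasure lborel {0::real..}"]
          by (metis infinity_ennreal_def leD less_top)
        thus ?thesis by (simp add: emeasure_restrict_space)
      qed
      ultimately show False using fin by simp
    qed
    then obtain t0 where "t0 \<ge> 0" "w j \<le> integral {0..t0} (job_speed S j)"
      by (auto simp: work_done_def)
    from hitting_time[OF this assms(4)[OF j]] show ?thesis
      unfolding work_done_def by metis
  qed
  thus ?thesis unfolding completion_times_def by metis
qed

text \<open>Job \<open>j\<close> is counted on \<open>{0..<C j}\<close> only, where its speed
  integrates to \<open>w j\<close>. Restricting the sum to unfinished jobs keeps this an equality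
  even if a schedule works on a job after its completion.\<close>

lemma nn_integral_weighted_speeds:
  assumes "feasible \<alpha> p J S" "finite J" "\<alpha> > 0" "completion_times J w S C"
    and a: "\<And>j. j \<in> J \<Longrightarrow> 0 \<le> a j" and w: "\<And>j. j \<in> J \<Longrightarrow> 0 \<le> w j"
  shows "(\<integral>\<^sup>+ t. ennreal (\<Sum>j\<in>unfinished J w S t. a j * job_speed S j t) \<partial>lebesgue_on {0..})
    = ennreal (\<Sum>j\<in>J. a j * w j)"
proof -
  have "(\<integral>\<^sup>+ t. ennreal (\<Sum>j\<in>unfinished J w S t. a j * job_speed S j t) \<partial>lebesgue_on {0..})
    = (\<integral>\<^sup>+ t. (\<Sum>j\<in>J. ennreal (a j) * (ennreal (job_speed S j t) * indicator {0..<C j} t))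
        \<partial>lebesgue_on {0..})"
  proof (rule nn_integral_cong)
    fix t assume "t \<in> space (lebesgue_on {0::real..})"
    hence t: "t \<ge> 0" by simp
    have "ennreal (\<Sum>j\<in>unfinished J w S t. a j * job_speed S j t)
      = (\<Sum>j\<in>unfinished J w S t. ennreal (a j * job_speed S j t))"
      by (rule sum_ennreal[symmetric]) (auto simp: unfinished_def intro!: mult_nonneg_nonneg a job_speed_nonneg)
    also have "\<dots> = (\<Sum>j\<in>J. ennreal (a j) * (ennreal (job_speed S j t) * indicator {0..<C j} t))"
      by (rule sum.mono_neutral_cong_left)
         (use assms(2) t in \<open>auto simp: unfinished_eq[OF assms(4) t] ennreal_mult' a\<close>)
    finally show "ennreal (\<Sum>j\<in>unfinished J w S t. a j * job_speed S j t)
      = (\<Sum>j\<in>J. ennreal (a j) * (ennreal (job_speed S j t) * indicator {0..<C j} t))" .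
  qed
  also have "\<dots> = (\<Sum>j\<in>J. ennreal (a j) *
      (\<integral>\<^sup>+ t. ennreal (job_speed S j t) * indicator {0..<C j} t \<partial>lebesgue_on {0..}))"
  proof -
    have [measurable]: "(\<lambda>t. ennreal (job_speed S j t) * indicator {0..<C j} t)
        \<in> borel_measurable (lebesgue_on {0..})" if "j \<in> J" for j
    proof (intro borel_measurable_times_ennreal borel_measurable_indicator)
      show "(\<lambda>t. ennreal (job_speed S j t)) \<in> borel_measurable (lebesgue_on {0..})"
        using assms(1) that by (intro measurable_compose[OF _ measurable_ennreal])
          (auto simp: feasible_def)
      show "{0..<C j} \<in> sets (lebesgue_on {0..})"
        by (auto simp: sets_restrict_space_iff)
    qed
    show ?thesis
      by (subst nn_integral_sum) (auto intro!: sum.cong nn_integral_cmult)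
  qed
  also have "\<dots> = (\<Sum>j\<in>J. ennreal (a j * w j))"
  proof (rule sum.cong[OF refl])
    fix j assume j: "j \<in> J"
    interpret bounded_rate "job_speed S j" "p powr (1 / \<alpha>)"
      by (rule bounded_rate_job_speed[OF assms(1,2) j assms(3)])
    have "integral {0..C j} (job_speed S j) = w j"
      using assms(4) j by (simp add: completion_times_def work_done_def)
    thus "ennreal (a j) * (\<integral>\<^sup>+ t. ennreal (job_speed S j t) * indicator {0..<C j} t
        \<partial>lebesgue_on {0..}) = ennreal (a j * w j)"
      by (simp add: nn_integral_initial_open ennreal_mult' a[OF j])
  qed
  also have "\<dots> = ennreal (\<Sum>j\<in>J. a j * w j)"
    by (rule sum_ennreal) (use a w in auto)
  finally show ?thesis .
qed

section \<open>Lower bounds on the cost of a schedule\<close>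

lemma total_work_le_cost:
  assumes "feasible \<alpha> p J S" "finite J" "\<alpha> > 1" "completion_times J w S C"
    and w: "\<And>j. j \<in> J \<Longrightarrow> 0 < w j"
  shows "ennreal (\<Sum>j\<in>J. w j) \<le> cost \<alpha> J w S"
proof -
  have U: "of_nat (card (unfinished J w S t)) = (\<Sum>j\<in>J. indicator {0..<C j} t :: ennreal)"
    if "t \<ge> 0" for t
  proof -
    have "(\<Sum>j\<in>J. indicator {0..<C j} t :: ennreal) = (\<Sum>j\<in>unfinished J w S t. 1)"
      by (rule sum.mono_neutral_cong_right)
         (use assms(2) that in \<open>auto simp: unfinished_eq[OF assms(4) that]\<close>)
    thus ?thesis by simp
  qed
  \<comment> \<open>Splitting the integral of the sum into flow time and energy needs measurability.
    The unfinished and active sets vary with time, so both integrands are rewritten as sums over the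
    fixed set \<open>J\<close>.\<close>
  have m1: "(\<lambda>t. of_nat (card (unfinished J w S t)) :: ennreal) \<in> borel_measurable (lebesgue_on {0..})"
  proof (subst measurable_cong[OF U])
    show "(\<lambda>t. \<Sum>j\<in>J. indicator {0..<C j} t :: ennreal) \<in> borel_measurable (lebesgue_on {0..})"
      by (intro borel_measurable_sum borel_measurable_indicator) (auto simp: sets_restrict_space_iff)
  qed auto
  have m2: "(\<lambda>t. ennreal (total_power \<alpha> S t)) \<in> borel_measurable (lebesgue_on {0..})"
  proof (subst measurable_cong[where g = "\<lambda>t. ennreal (\<Sum>j\<in>J. job_speed S j t powr \<alpha>)"])
    have "job_speed S j \<in> borel_measurable (lebesgue_on {0..})" if "j \<in> J" for j
      using assms(1) that by (auto simp: feasible_def)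
    thus "(\<lambda>t. ennreal (\<Sum>j\<in>J. job_speed S j t powr \<alpha>)) \<in> borel_measurable (lebesgue_on {0..})"
      by (intro measurable_compose[OF _ measurable_ennreal] borel_measurable_sum
            powr_real_measurable) auto
  qed (use sum_job_speed_powr[OF assms(1,2)] in auto)
  have "ennreal (\<Sum>j\<in>J. w j)
      = (\<integral>\<^sup>+ t. ennreal (\<Sum>j\<in>unfinished J w S t. 1 * job_speed S j t) \<partial>lebesgue_on {0..})"
    by (subst nn_integral_weighted_speeds[OF assms(1,2) _ assms(4)]) (use assms(3) w in \<open>auto simp: less_imp_le\<close>)
  also have "\<dots> \<le> (\<integral>\<^sup>+ t. of_nat (card (unfinished J w S t)) + ennreal (total_power \<alpha> S t)
      \<partial>lebesgue_on {0..})"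
  proof (rule nn_integral_mono)
    fix t assume "t \<in> space (lebesgue_on {0::real..})"
    hence t: "t \<ge> 0" by simp
    have le: "x \<le> 1 + x powr \<alpha>" if "x \<ge> 0" for x :: real
      using powr_mono[of 1 \<alpha> x] assms(3) that by (cases "x \<le> 1") (auto simp: add_increasing2)
    have UJ: "unfinished J w S t \<subseteq> J" by (auto simp: unfinished_def)
    have "(\<Sum>j\<in>unfinished J w S t. 1 * job_speed S j t)
        \<le> (\<Sum>j\<in>unfinished J w S t. 1 + job_speed S j t powr \<alpha>)"
      by (intro sum_mono) (simp add: le job_speed_nonneg)
    also have "\<dots> = real (card (unfinished J w S t)) + (\<Sum>j\<in>unfinished J w S t. job_speed S j t powr \<alpha>)"
      by (simp add: sum.distrib)
    also have "\<dots> \<le> real (card (unfinished J w S t)) + (\<Sum>j\<in>J. job_speed S j t powr \<alpha>)"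
      by (intro add_left_mono sum_mono2) (use assms(2) UJ in auto)
    also have "\<dots> = real (card (unfinished J w S t)) + total_power \<alpha> S t"
      by (simp add: sum_job_speed_powr[OF assms(1,2) t])
    finally have "ennreal (\<Sum>j\<in>unfinished J w S t. 1 * job_speed S j t)
        \<le> ennreal (real (card (unfinished J w S t)) + total_power \<alpha> S t)"
      by (rule ennreal_leI)
    also have "\<dots> = of_nat (card (unfinished J w S t)) + ennreal (total_power \<alpha> S t)"
      by (subst ennreal_plus)
         (auto simp: ennreal_of_nat_eq_real_of_nat total_power_def power_of_def intro!: sum_nonneg)
    finally show "ennreal (\<Sum>j\<in>unfinished J w S t. 1 * job_speed S j t)
        \<le> of_nat (card (unfinished J w S t)) + ennreal (total_power \<alpha> S t)" .
  qed
  also have "\<dots> = cost \<alpha> J w S"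
    unfolding cost_def flow_time_def energy_def by (rule nn_integral_add[OF m1 m2])
  finally show ?thesis .
qed

text \<open>For a rank \<open>r >= p\<close> this is the reciprocal of
  \<open>equi_speed \<alpha> p r\<close>. The ranks come from the completion order of the competing
  schedule, ties included.\<close>

definition rank_weight :: "real \<Rightarrow> real \<Rightarrow> 'j set \<Rightarrow> ('j \<Rightarrow> real) \<Rightarrow> 'j \<Rightarrow> real" where
  "rank_weight \<alpha> p J C j = (real (card {k\<in>J. C j \<le> C k}) / p) powr (1 / \<alpha>)"

lemma rank_weighted_work_le_flow_time:
  assumes "feasible \<alpha> p J S" "finite J" "\<alpha> > 1" "p > 0" "completion_times J w S C"
    and w: "\<And>j. j \<in> J \<Longrightarrow> 0 < w j"
  shows "ennreal (\<Sum>j\<in>J. rank_weight \<alpha> p J C j * w j) \<le> flow_time J w S"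
proof -
  have "ennreal (\<Sum>j\<in>J. rank_weight \<alpha> p J C j * w j)
      = (\<integral>\<^sup>+ t. ennreal (\<Sum>j\<in>unfinished J w S t. rank_weight \<alpha> p J C j * job_speed S j t)
          \<partial>lebesgue_on {0..})"
    by (rule nn_integral_weighted_speeds[symmetric, OF assms(1,2) _ assms(5)])
       (use assms(3) w in \<open>auto simp: less_imp_le rank_weight_def\<close>)
  also have "\<dots> \<le> flow_time J w S"
    unfolding flow_time_def
  proof (rule nn_integral_mono)
    fix t assume "t \<in> space (lebesgue_on {0::real..})"
    hence t: "t \<ge> 0" by simp
    define U where "U = unfinished J w S t"
    define n where "n = card U"
    define y where "y = (real n / p) powr (1 / \<alpha>)"
    have UJ: "U \<subseteq> J" by (auto simp: U_def unfinished_def)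
    have young: "rank_weight \<alpha> p J C j * s \<le> (1 - 1 / \<alpha>) + (real n / (p * \<alpha>)) * s powr \<alpha>"
      if j: "j \<in> U" and s: "s \<ge> 0" for j s
    proof -
      \<comment> \<open>Every job completing no earlier than an unfinished job is itself
        unfinished.\<close>
      have "{k\<in>J. C j \<le> C k} \<subseteq> U"
        using j by (auto simp: U_def unfinished_eq[OF assms(5) t])
      hence "card {k\<in>J. C j \<le> C k} \<le> n"
        unfolding n_def using finite_subset[OF UJ assms(2)] by (rule card_mono[rotated])
      hence "rank_weight \<alpha> p J C j \<le> y"
        unfolding rank_weight_def y_def using assms(3,4)
        by (intro powr_mono2 divide_right_mono) auto
      hence "rank_weight \<alpha> p J C j * s \<le> y * s" using s by (rule mult_right_mono)
      also have "1 + \<alpha> * (y * s - 1) \<le> (y * s) powr \<alpha>"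
        using assms(3) s by (intro powr_ge_tangent_at_1) (auto simp: y_def)
      hence "(1 + \<alpha> * (y * s - 1)) / \<alpha> \<le> (y * s) powr \<alpha> / \<alpha>"
        using assms(3) by (intro divide_right_mono) auto
      hence "y * s \<le> (1 - 1 / \<alpha>) + (y * s) powr \<alpha> / \<alpha>"
        using assms(3) by (simp add: add_divide_distrib)
      also have "(y * s) powr \<alpha> = real n / p * s powr \<alpha>"
        using assms(3,4) s by (simp add: y_def powr_mult powr_powr)
      finally show ?thesis by (simp add: mult.commute)
    qed
    have "(\<Sum>j\<in>U. rank_weight \<alpha> p J C j * job_speed S j t)
        \<le> (\<Sum>j\<in>U. (1 - 1 / \<alpha>) + (real n / (p * \<alpha>)) * job_speed S j t powr \<alpha>)"
      by (intro sum_mono young job_speed_nonneg)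
    also have "\<dots> = real n * (1 - 1 / \<alpha>) + (real n / (p * \<alpha>)) * (\<Sum>j\<in>U. job_speed S j t powr \<alpha>)"
      by (simp add: sum.distrib sum_distrib_left n_def)
    \<comment> \<open>The scaling of the weights pays off here: total power at most \<open>p\<close>
      turns the second term into \<open>n / \<alpha>\<close>, and the two terms add up to
      \<open>n\<close>.\<close>
    also have "\<dots> \<le> real n * (1 - 1 / \<alpha>) + (real n / (p * \<alpha>)) * p"
    proof (intro add_left_mono mult_left_mono)
      have "(\<Sum>j\<in>U. job_speed S j t powr \<alpha>) \<le> (\<Sum>j\<in>J. job_speed S j t powr \<alpha>)"
        using assms(2) UJ by (intro sum_mono2) auto
      also have "\<dots> \<le> p"
        using assms(1) t by (simp add: sum_job_speed_powr[OF assms(1,2) t] feasible_def)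
      finally show "(\<Sum>j\<in>U. job_speed S j t powr \<alpha>) \<le> p" .
    qed (use assms in auto)
    also have "\<dots> = real n" using assms by (simp add: field_simps)
    finally show "ennreal (\<Sum>j\<in>unfinished J w S t. rank_weight \<alpha> p J C j * job_speed S j t)
        \<le> of_nat (card (unfinished J w S t))"
      unfolding U_def n_def ennreal_of_nat_eq_real_of_nat by (rule ennreal_leI)
  qed
  finally show ?thesis .
qed

section \<open>Upper bounds for EQUI\<close>

lemma job_speed_equi:
  assumes "equi \<alpha> p J w S" "t \<ge> 0"
  shows "job_speed S j t =
    (if j \<in> unfinished J w S t then equi_speed \<alpha> p (card (unfinished J w S t)) else 0)"
proof -
  have bij: "bij_betw (\<lambda>i. assigned S i t) (active S t) (Some ` unfinished J w S t)"
    and sp: "\<And>i. i \<in> active S t \<Longrightarrow> speed S i t = equi_speed \<alpha> p (card (unfinished J w S t))"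
    and feas: "feasible \<alpha> p J S"
    using assms by (auto simp: equi_def)
  have img: "(\<lambda>i. assigned S i t) ` active S t = Some ` unfinished J w S t"
    using bij by (rule bij_betw_imp_surj_on)
  show ?thesis
  proof (cases "j \<in> unfinished J w S t")
    case True
    hence "Some j \<in> (\<lambda>i. assigned S i t) ` active S t" unfolding img by simp
    then obtain i where i: "i \<in> active S t" "assigned S i t = Some j" by auto
    show ?thesis using True sp[OF i(1)] job_speed_active[OF feas assms(2) i] by simp
  next
    case False
    hence "Some j \<notin> (\<lambda>i. assigned S i t) ` active S t" unfolding img by auto
    hence "job_speed S j t = 0" by (intro job_speed_idle) (metis imageI)
    thus ?thesis using False by simp
  qed
qed

text \<open>Each of the \<open>n\<close> unfinished jobs uses power \<open>min n p / n\<close>, so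
  the total is \<open>min n p\<close>, which is at most \<open>n\<close>. The case
  \<open>n = 0\<close> is separate because the formula for \<open>equi_speed\<close> requires
  \<open>n > 0\<close>.\<close>

lemma energy_equi_le_flow_time:
  assumes "equi \<alpha> p J w S" "\<alpha> > 1" "p > 0" "finite J"
  shows "energy \<alpha> S \<le> flow_time J w S"
  unfolding energy_def flow_time_def
proof (rule nn_integral_mono)
  fix t assume "t \<in> space (lebesgue_on {0::real..})"
  hence t: "t \<ge> 0" by simp
  define n where "n = card (unfinished J w S t)"
  have "total_power \<alpha> S t = (\<Sum>j\<in>J. job_speed S j t powr \<alpha>)"
    using assms(1,4) t by (intro sum_job_speed_powr[symmetric, of _ p]) (auto simp: equi_def)
  also have "\<dots> = (\<Sum>j\<in>unfinished J w S t. equi_speed \<alpha> p n powr \<alpha>)"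
    by (rule sum.mono_neutral_cong_right)
       (use assms(4) in \<open>auto simp: job_speed_equi[OF assms(1) t] n_def unfinished_def\<close>)
  also have "\<dots> = real n * equi_speed \<alpha> p n powr \<alpha>" by (simp add: n_def)
  also have "\<dots> \<le> real n"
  proof (cases "n = 0")
    case False
    hence "equi_speed \<alpha> p n powr \<alpha> = min (real n) p / real n"
      using assms(2,3) by (simp add: equi_speed_eq powr_powr)
    thus ?thesis using False by simp
  qed simp
  finally show "ennreal (total_power \<alpha> S t) \<le> of_nat (card (unfinished J w S t))"
    unfolding n_def ennreal_of_nat_eq_real_of_nat by (rule ennreal_leI)
qed

text \<open>The two summands of the coefficient serve two regimes. For \<open>card U <= p\<close>
  the speed is 1 and the summand 1 suffices. Otherwise the speed is
  \<open>(p / card U) powr (1 / \<alpha>)\<close>, its factor \<open>p\<close> cancels the one in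
  the weights, and \<open>sum_rank_powr_ge\<close> bounds the rank part alone.\<close>

lemma card_le_equi_speed_rank_weights:
  assumes "\<alpha> > 1" "p > 0" "finite J" "U \<subseteq> J"
  shows "real (card U) \<le>
    (\<Sum>j\<in>U. (1 + (1 + 1 / \<alpha>) * rank_weight \<alpha> p J C j) * equi_speed \<alpha> p (card U))"
proof (cases "card U = 0")
  case True
  thus ?thesis using finite_subset[OF assms(4,3)] by simp
next
  case False
  define n where "n = card U"
  define b where "b = 1 / \<alpha>"
  have n: "n > 0" using False by (simp add: n_def)
  have b: "b > 0" using assms(1) by (simp add: b_def)
  have sp: "equi_speed \<alpha> p n = (min (real n) p / real n) powr b"
    using equi_speed_eq[OF assms(1,2) n] by (simp add: b_def)
  show ?thesis
  proof (cases "real n \<le> p")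
    case True
    hence "equi_speed \<alpha> p n = 1" using sp n by (simp add: min_def)
    moreover have "(\<Sum>j\<in>U. 1) \<le> (\<Sum>j\<in>U. 1 + (1 + 1 / \<alpha>) * rank_weight \<alpha> p J C j)"
      using assms(1) by (intro sum_mono) (simp add: rank_weight_def)
    ultimately show ?thesis by (simp add: n_def)
  next
    case False
    have e: "equi_speed \<alpha> p n = p powr b / real n powr b"
      using sp False assms(2) n by (simp add: min_def powr_divide)
    have "real n = real n powr (1 + b) / real n powr b"
      using n by (simp add: powr_add)
    also have "\<dots> \<le> ((1 + b) * (\<Sum>j\<in>U. real (card {k\<in>J. C j \<le> C k}) powr b)) / real n powr b"
      using sum_rank_powr_ge[OF assms(3,4), of b C] b n
      by (intro divide_right_mono) (auto simp: n_def field_simps)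
    also have "\<dots> = (\<Sum>j\<in>U. ((1 + b) * rank_weight \<alpha> p J C j) * equi_speed \<alpha> p n)"
      using assms(2) n
      by (simp add: e rank_weight_def b_def[symmetric] powr_divide sum_distrib_left sum_divide_distrib)
    also have "\<dots> \<le> (\<Sum>j\<in>U. (1 + (1 + b) * rank_weight \<alpha> p J C j) * equi_speed \<alpha> p n)"
      by (intro sum_mono mult_right_mono) (auto simp: e)
    finally show ?thesis by (simp add: n_def b_def)
  qed
qed

text \<open>Here \<open>C\<close> is arbitrary; it will be taken from the competing schedule. The
  pointwise bound on the number of unfinished jobs is integrated, and each speed integrates to at
  most \<open>w j\<close> because EQUI stops working on a completed job.\<close>

lemma equi_flow_time_le:
  assumes "equi \<alpha> p J w S" "\<alpha> > 1" "p > 0" "finite J" and w: "\<And>j. j \<in> J \<Longrightarrow> 0 < w j"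
  shows "flow_time J w S
    \<le> ennreal (\<Sum>j\<in>J. (1 + (1 + 1 / \<alpha>) * rank_weight \<alpha> p J C j) * w j)"
proof -
  define a where "a j = 1 + (1 + 1 / \<alpha>) * rank_weight \<alpha> p J C j" for j
  have a: "a j \<ge> 0" for j using assms(2) by (simp add: a_def rank_weight_def)
  have feas: "feasible \<alpha> p J S" using assms(1) by (simp add: equi_def)
  have "flow_time J w S \<le> (\<integral>\<^sup>+ t. (\<Sum>j\<in>J. ennreal (a j) * ennreal (job_speed S j t)) \<partial>lebesgue_on {0..})"
    unfolding flow_time_def
  proof (rule nn_integral_mono)
    fix t assume "t \<in> space (lebesgue_on {0::real..})"
    hence t: "t \<ge> 0" by simp
    have UJ: "unfinished J w S t \<subseteq> J" by (auto simp: unfinished_def)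
    have "real (card (unfinished J w S t)) \<le> (\<Sum>j\<in>unfinished J w S t. a j * job_speed S j t)"
      using card_le_equi_speed_rank_weights[OF assms(2,3,4) UJ, of C]
      by (simp add: a_def job_speed_equi[OF assms(1) t])
    also have "\<dots> \<le> (\<Sum>j\<in>J. a j * job_speed S j t)"
      using assms(4) UJ by (intro sum_mono2) (auto intro!: mult_nonneg_nonneg a job_speed_nonneg)
    finally have "ennreal (real (card (unfinished J w S t))) \<le> ennreal (\<Sum>j\<in>J. a j * job_speed S j t)"
      by (rule ennreal_leI)
    also have "\<dots> = (\<Sum>j\<in>J. ennreal (a j * job_speed S j t))"
      by (rule sum_ennreal[symmetric]) (auto intro!: mult_nonneg_nonneg a job_speed_nonneg)
    finally show "of_nat (card (unfinished J w S t)) \<le> (\<Sum>j\<in>J. ennreal (a j) * ennreal (job_speed S j t))"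
      by (simp add: ennreal_of_nat_eq_real_of_nat ennreal_mult' a)
  qed
  also have "\<dots> = (\<Sum>j\<in>J. ennreal (a j) * (\<integral>\<^sup>+ t. ennreal (job_speed S j t) \<partial>lebesgue_on {0..}))"
  proof -
    have [measurable]: "(\<lambda>t. ennreal (job_speed S j t)) \<in> borel_measurable (lebesgue_on {0..})"
      if "j \<in> J" for j
      using feas that by (intro measurable_compose[OF _ measurable_ennreal]) (auto simp: feasible_def)
    show ?thesis by (subst nn_integral_sum) (auto intro!: sum.cong nn_integral_cmult)
  qed
  also have "\<dots> \<le> (\<Sum>j\<in>J. ennreal (a j) * ennreal (w j))"
  proof (intro sum_mono mult_left_mono)
    fix j assume j: "j \<in> J"
    interpret bounded_rate "job_speed S j" "p powr (1 / \<alpha>)"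
      by (rule bounded_rate_job_speed[OF feas assms(4) j]) (use assms(2) in simp)
    show "(\<integral>\<^sup>+ t. ennreal (job_speed S j t) \<partial>lebesgue_on {0..}) \<le> ennreal (w j)"
    proof (rule nn_integral_le_if_stopping[OF _ w[OF j]])
      fix t :: real assume t: "t \<ge> 0" "w j \<le> integral {0..t} (job_speed S j)"
      hence "j \<notin> unfinished J w S t" by (simp add: unfinished_def work_done_def)
      thus "job_speed S j t = 0" by (simp add: job_speed_equi[OF assms(1) t(1)])
    qed
  qed simp
  also have "\<dots> = (\<Sum>j\<in>J. ennreal (a j * w j))"
    by (simp add: ennreal_mult' a)
  also have "\<dots> = ennreal (\<Sum>j\<in>J. a j * w j)"
    by (rule sum_ennreal) (use a w in \<open>auto simp: less_imp_le\<close>)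
  finally show ?thesis by (simp add: a_def)
qed

section \<open>The competitive ratio\<close>

text \<open>The partial fraction form shows positivity and monotonicity at once.\<close>

lemma mu_eq: "\<alpha> > 1 \<Longrightarrow> mu \<alpha> = 4 + 2 / (\<alpha> - 1)"
  by (simp add: mu_def field_simps)

lemma twice_le_mu:
  assumes "\<alpha> > 1"
  shows "2 * (2 + 1 / \<alpha>) \<le> mu \<alpha>"
proof -
  have "1 / \<alpha> \<le> 1 / (\<alpha> - 1)" using assms by (intro divide_left_mono) auto
  thus ?thesis using assms by (simp add: mu_eq)
qed

lemma cost_equi_le:
  assumes "equi \<alpha> p J w E" "feasible \<alpha> p J S" "\<alpha> > 1" "p > 0" "finite J"
    and w: "\<And>j. j \<in> J \<Longrightarrow> 0 < w j"
  shows "cost \<alpha> J w E \<le> ennreal (mu \<alpha>) * cost \<alpha> J w S"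
proof (cases "cost \<alpha> J w S = \<infinity>")
  case True
  moreover have "mu \<alpha> > 0" using assms(3) by (simp add: mu_eq add_pos_pos)
  ultimately show ?thesis by (simp add: ennreal_mult_top)
next
  case False
  hence fin: "flow_time J w S < \<infinity>" by (simp add: cost_def less_top)
  obtain C where C: "completion_times J w S C"
    using completion_times_exist[OF assms(2,5) _ w fin] assms(3) by auto
  define a where "a = rank_weight \<alpha> p J C"
  have W: "ennreal (\<Sum>j\<in>J. w j) \<le> cost \<alpha> J w S"
    by (rule total_work_le_cost[OF assms(2,5,3) C w])
  have A: "ennreal (\<Sum>j\<in>J. a j * w j) \<le> cost \<alpha> J w S"
    unfolding a_def cost_def
    by (rule order_trans[OF rank_weighted_work_le_flow_time[OF assms(2,5,3,4) C w]]) auto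
  have pos: "0 \<le> (\<Sum>j\<in>J. w j)" "0 \<le> (\<Sum>j\<in>J. a j * w j)"
    using w by (auto simp: a_def rank_weight_def less_imp_le intro!: sum_nonneg mult_nonneg_nonneg)
  \<comment> \<open>Energy at most flow time costs a factor 2. Below, the total work contributes 1
    and the weighted work \<open>1 + 1 / \<alpha>\<close> times the competing cost.\<close>
  have "cost \<alpha> J w E \<le> 2 * flow_time J w E"
    unfolding cost_def mult_2
    by (intro add_left_mono energy_equi_le_flow_time[OF assms(1,3,4,5)])
  also have "flow_time J w E \<le> ennreal (\<Sum>j\<in>J. (1 + (1 + 1 / \<alpha>) * a j) * w j)"
    unfolding a_def by (rule equi_flow_time_le[OF assms(1,3,4,5) w])
  also have "(\<Sum>j\<in>J. (1 + (1 + 1 / \<alpha>) * a j) * w j)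
      = (\<Sum>j\<in>J. w j) + (1 + 1 / \<alpha>) * (\<Sum>j\<in>J. a j * w j)"
    by (simp add: algebra_simps sum.distrib sum_distrib_left)
  also have "ennreal \<dots> = ennreal (\<Sum>j\<in>J. w j) + ennreal (1 + 1 / \<alpha>) * ennreal (\<Sum>j\<in>J. a j * w j)"
    using pos assms(3) by (simp add: ennreal_plus ennreal_mult)
  also have "\<dots> \<le> cost \<alpha> J w S + ennreal (1 + 1 / \<alpha>) * cost \<alpha> J w S"
    by (intro add_mono mult_left_mono W A) auto
  also have "\<dots> = ennreal (2 + 1 / \<alpha>) * cost \<alpha> J w S"
  proof -
    have "ennreal (2 + 1 / \<alpha>) = 1 + ennreal (1 + 1 / \<alpha>)"
      using assms(3) ennreal_plus[of 1 "1 + 1 / \<alpha>"] by simp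
    thus ?thesis by (simp add: distrib_right)
  qed
  also have "2 * (ennreal (2 + 1 / \<alpha>) * cost \<alpha> J w S) = ennreal (2 * (2 + 1 / \<alpha>)) * cost \<alpha> J w S"
  proof -
    have "ennreal (2 * (2 + 1 / \<alpha>)) = 2 * ennreal (2 + 1 / \<alpha>)"
      by (subst ennreal_mult') simp_all
    thus ?thesis by (simp only: mult.assoc)
  qed
  also have "\<dots> \<le> ennreal (mu \<alpha>) * cost \<alpha> J w S"
    by (intro mult_right_mono ennreal_leI twice_le_mu assms(3)) simp
  finally show ?thesis by (simp add: mult_left_mono)
qed

theorem theorem1:
  fixes \<alpha> p :: real
  assumes "\<alpha> > 1" and "p > 0"
  shows "competitive_ratio \<alpha> p (equi \<alpha> p :: 'j set \<Rightarrow> ('j \<Rightarrow> real) \<Rightarrow> 'j schedule \<Rightarrow> bool)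
           \<le> ennreal (mu \<alpha>)
         \<and> mu 2 = 6 \<and> strict_antimono_on {1<..} mu"
proof (intro conjI)
  have ratio: "cost \<alpha> J w E / opt_cost \<alpha> p J w \<le> ennreal (mu \<alpha>)"
    if "finite J" "\<forall>j\<in>J. 0 < w j" "equi \<alpha> p J w E"
    for J and w :: "'j \<Rightarrow> real" and E
  proof -
    have mu: "mu \<alpha> > 0" using assms(1) by (simp add: mu_eq add_pos_pos)
    \<comment> \<open>Dividing by \<open>mu \<alpha>\<close> first gives a lower bound common to all
      competing costs, hence one for their infimum.\<close>
    have "cost \<alpha> J w E / ennreal (mu \<alpha>) \<le> opt_cost \<alpha> p J w"
      unfolding opt_cost_def
    proof (rule INF_greatest)
      fix S assume "S \<in> {S. feasible \<alpha> p J S}"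
      hence "cost \<alpha> J w E \<le> ennreal (mu \<alpha>) * cost \<alpha> J w S"
        using that assms by (intro cost_equi_le) auto
      thus "cost \<alpha> J w E / ennreal (mu \<alpha>) \<le> cost \<alpha> J w S"
        using mu by (intro divide_le_posI_ennreal) auto
    qed
    hence "cost \<alpha> J w E / ennreal (mu \<alpha>) * ennreal (mu \<alpha>) \<le> opt_cost \<alpha> p J w * ennreal (mu \<alpha>)"
      by (rule mult_right_mono) simp
    moreover have "cost \<alpha> J w E / ennreal (mu \<alpha>) * ennreal (mu \<alpha>) = cost \<alpha> J w E"
      using mu by (simp add: ennreal_divide_times)
    ultimately have le: "cost \<alpha> J w E \<le> opt_cost \<alpha> p J w * ennreal (mu \<alpha>)"
      by simp
    show ?thesis
    \<comment> \<open>If the optimum is 0, then so is the cost of EQUI, and \<open>0 / 0 = 0\<close>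
      in \<open>ennreal\<close>.\<close>
    proof (cases "opt_cost \<alpha> p J w = 0")
      case True
      thus ?thesis using le by simp
    next
      case False
      thus ?thesis using le by (intro divide_le_posI_ennreal) (auto simp: zero_less_iff_neq_zero)
    qed
  qed
  show "competitive_ratio \<alpha> p (equi \<alpha> p :: 'j set \<Rightarrow> ('j \<Rightarrow> real) \<Rightarrow> 'j schedule \<Rightarrow> bool)
      \<le> ennreal (mu \<alpha>)"
    unfolding competitive_ratio_def
    by (auto simp: instances_def intro!: SUP_least ratio)
  show "mu 2 = 6" by (simp add: mu_def)
  show "strict_antimono_on {1<..} mu"
  proof (rule monotone_onI)
    fix x y :: real assume "x \<in> {1<..}" "y \<in> {1<..}" "x < y"
    thus "mu y < mu x" by (simp add: mu_eq divide_strict_left_mono)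
  qed
qed

end
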